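(* Let $0 < \alpha < 1$, let $\xi_n = \alpha 2^{-n} + (1-\alpha)3^{-n}$ for $n \geq 0$, and let $B \subseteq [0,1]$ be the generalized Cantor set associated with the sequence $(\xi_n)$, so that its Lebesgue measure is $|B| = \alpha$. Then there exists a continuous function $f \colon [0,1] \to \mathbb{R}$ that fails to have bounded variation on $[0,1]$ and that cuts the real axis at every $x \in B$.
   Context: A function $f \colon [0,1] \to \mathbb{R}$ cuts the real axis at a point $x \in [0,1]$ provided that $f(x)=0$ and for every $\delta>0$ there exist $x_1, x_2 \in [0,1]$ such that $|x-x_i|<\delta$ for $i=1,2$ and $f(x_1)<0<f(x_2)$. A function $f \colon [0,1] \to \mathbb{R}$ has bounded variation provided that $\sup_P \sum_{i=1}^n |f(t_i)-f(t_{i-1})| < \infty$, where the supremum is taken over all partitions $P=\{0=t_0<t_1<\cdots<t_n=1\}$ of $[0,1]$. Generalized Cantor set: let $(\xi_n)_{n\ge 0}$ be a sequence of positive numbers with $\xi_0=1$ and $\xi_n > 2\xi_{n+1}$ for all $n$ (the sequence $\xi_n = \alpha 2^{-n}+(1-\alpha)3^{-n}$ satisfies this). Let $B_0=[0,1]$. Remove from $[0,1]$ the open middle interval of length $\xi_0-2\xi_1$, obtaining $B_1=[0,\xi_1]\cup[1-\xi_1,1]$. Inductively, having constructed $B_n$ as a union of $2^n$ disjoint closed intervals of length $\xi_n$, remove from each of these intervals the open middle interval (centered at its midpoint) of length $\xi_n-2\xi_{n+1}$ to obtain $B_{n+1}$, a union of $2^{n+1}$ disjoint closed intervals of length $\xi_{n+1}$.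 The generalized Cantor set associated with $(\xi_n)$ is $B=\bigcap_{n} B_n$; its Lebesgue measure is $|B|=\lim_{n\to\infty} 2^n\xi_n$. *)

theory Defs
  imports "HOL-Analysis.Analysis"
begin

definition cuts_axis_at :: "(real \<Rightarrow> real) \<Rightarrow> real \<Rightarrow> bool" where
  "cuts_axis_at f x \<longleftrightarrow> x \<in> {0..1} \<and> f x = 0 \<and>
     (\<forall>\<delta>>0. \<exists>x1\<in>{0..1}. \<exists>x2\<in>{0..1}.
        \<bar>x - x1\<bar> < \<delta> \<and> \<bar>x - x2\<bar> < \<delta> \<and> f x1 < 0 \<and> 0 < f x2)"

definition unit_partition :: "nat \<Rightarrow> (nat \<Rightarrow> real) \<Rightarrow> bool" where
  "unit_partition n t \<longleftrightarrow> t 0 = 0 \<and> t n = 1 \<and> (\<forall>i<n. t i < t (Suc i))"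

definition bounded_variation_unit :: "(real \<Rightarrow> real) \<Rightarrow> bool" where
  "bounded_variation_unit f \<longleftrightarrow>
     bdd_above {\<Sum>i=1..n. \<bar>f (t i) - f (t (i - 1))\<bar> | n t. unit_partition n t}"

text \<open>
  A closed interval is represented by the pair of its endpoints;
  \<open>remove_middle d\<close> removes from it the open interval of length \<open>d\<close>
  centered at its midpoint, and returns the two closed intervals that remain
  (for \<open>0 < d\<close> smaller than the length of the interval).
\<close>

definition remove_middle :: "real \<Rightarrow> real \<times> real \<Rightarrow> (real \<times> real) set" where
  "remove_middle d = (\<lambda>(a, b). {(a, (a + b) / 2 - d / 2), ((a + b) / 2 + d / 2, b)})"

primrec cantor_intervals :: "(nat \<Rightarrow> real) \<Rightarrow> nat \<Rightarrow> (real \<times> real) set" where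
  "cantor_intervals \<xi> 0 = {(0, 1)}"
| "cantor_intervals \<xi> (Suc n) =
     (\<Union>I\<in>cantor_intervals \<xi> n. remove_middle (\<xi> n - 2 * \<xi> (Suc n)) I)"

definition cantor_stage :: "(nat \<Rightarrow> real) \<Rightarrow> nat \<Rightarrow> real set" where
  "cantor_stage \<xi> n = (\<Union>(a, b)\<in>cantor_intervals \<xi> n. {a..b})"

text \<open>
  Only meaningful for positive \<open>\<xi>\<close> with \<open>\<xi> 0 = 1\<close> and \<open>\<xi> n > 2 * \<xi> (Suc n)\<close> for all \<open>n\<close>.
\<close>

definition generalized_cantor_set :: "(nat \<Rightarrow> real) \<Rightarrow> real set" where
  "generalized_cantor_set \<xi> = (\<Inter>n. cantor_stage \<xi> n)"

lemma remove_middle_diff: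
  assumes "0 < d" "d < b - a"
  shows "{a..b} - {(a + b) / 2 - d / 2 <..< (a + b) / 2 + d / 2} =
    (\<Union>(u, v)\<in>remove_middle d (a, b). {u..v})"
  using assms by (auto simp: remove_middle_def field_simps)

lemma cantor_intervals_length:
  assumes "\<xi> 0 = 1" "(a, b) \<in> cantor_intervals \<xi> n"
  shows "b - a = \<xi> n"
  using assms(2)
proof (induction n arbitrary: a b)
  case 0
  then show ?case using assms(1) by simp
next
  case (Suc n)
  then obtain u v where uv: "(u, v) \<in> cantor_intervals \<xi> n"
    "(a, b) \<in> remove_middle (\<xi> n - 2 * \<xi> (Suc n)) (u, v)"
    by auto
  from Suc.IH[OF uv(1)] uv(2) show ?case
    by (auto simp: remove_middle_def field_simps)
qed

lemma cantor_stage_1: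
  assumes "\<xi> 0 = 1"
  shows "cantor_stage \<xi> 1 = {0..\<xi> 1} \<union> {1 - \<xi> 1..1}"
  using assms by (simp add: cantor_stage_def remove_middle_def diff_divide_distrib add_divide_distrib)

lemma admissible_sequence:
  fixes \<alpha> :: real
  assumes "0 < \<alpha>" "\<alpha> < 1" and \<xi>: "\<And>n. \<xi> n = \<alpha> / 2 ^ n + (1 - \<alpha>) / 3 ^ n"
  shows "\<xi> 0 = 1" "0 < \<xi> n" "2 * \<xi> (Suc n) < \<xi> n"
proof -
  show "\<xi> 0 = 1" by (simp add: \<xi>)
  show "0 < \<xi> n" using assms(1,2) by (simp add: \<xi> add_pos_pos)
  have "2 * \<xi> (Suc n) = \<alpha> / 2 ^ n + (2 / 3) * ((1 - \<alpha>) / 3 ^ n)"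
    by (simp add: \<xi> field_simps)
  moreover have "0 < (1 - \<alpha>) / 3 ^ n" using assms(2) by simp
  ultimately show "2 * \<xi> (Suc n) < \<xi> n" unfolding \<xi>[of n] by linarith
qed

end

theory Submission
  imports Defs
begin

text \<open>
  Let \<open>D x\<close> be the distance from \<open>x\<close> to \<open>B\<close>, and let \<open>f x = D x * sin (1 / D x)\<close>, with value \<open>0\<close>
  on \<open>B\<close>. This function is continuous because \<open>D\<close> and \<open>t * sin (1 / t)\<close> are. It has the other two
  properties for every closed \<open>B \<subseteq> {0..1}\<close> that contains \<open>0\<close> and whose complement is dense in
  \<open>{0..1}\<close>.

  \<^item> \<^emph>\<open>Cutting the axis.\<close> Arbitrarily close to \<open>x \<in> B\<close> there is a \<open>y \<notin> B\<close>. On the segment from \<open>x\<close>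
    to \<open>y\<close> the continuous function \<open>D\<close> takes all values between \<open>0\<close> and \<open>D y > 0\<close>, and
    \<open>t * sin (1 / t)\<close> takes both signs at arbitrarily small \<open>t > 0\<close>
    (\<open>oscillation_cuts_axis\<close>).
  \<^item> \<^emph>\<open>Unbounded variation.\<close> Immediately to the right of the last point \<open>c\<close> of \<open>B\<close> before a
    point outside \<open>B\<close>, \<open>D (c + t) = t\<close> (\<open>infdist_right_of_set\<close>). There \<open>f\<close> is a copy of \<open>t * sin (1 / t)\<close>, whose
    successive extrema have the size of the terms of the harmonic series
    (\<open>oscillation_unbounded_variation\<close>).

  About the Cantor set it remains to show that distinct intervals of one stage are disjoint
  (\<open>interval_eqI\<close>). This gives the measure of each stage (\<open>emeasure_stage\<close>), hence that of the
  intersection, by continuity from above. It also shows that the midpoint of an interval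
  of stage \<open>n\<close> is not in stage \<open>n + 1\<close>. As the lengths tend to \<open>0\<close>, these
  midpoints are points outside \<open>B\<close> that come close to every point of \<open>B\<close>
  (\<open>cantor_subset_closure_complement\<close>).
\<close>

section \<open>The generalized Cantor set\<close>

locale cantor_sequence =
  fixes \<xi> :: "nat \<Rightarrow> real"
  assumes start: "\<xi> 0 = 1"
    and pos: "0 < \<xi> n"
    and halves: "2 * \<xi> (Suc n) < \<xi> n"
begin

lemma tendsto_0: "\<xi> \<longlonglongrightarrow> 0"
proof -
  have bound: "\<xi> n \<le> (1 / 2) ^ n" for n
  proof (induction n)
    case (Suc n)
    then show ?case using halves[of n] by simp
  qed (simp add: start)
  show ?thesis
  proof (rule tendsto_sandwich)
    show "\<forall>\<^sub>F n in sequentially. 0 \<le> \<xi> n"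
      by (intro always_eventually allI less_imp_le pos)
    show "\<forall>\<^sub>F n in sequentially. \<xi> n \<le> (1 / 2) ^ n"
      by (intro always_eventually allI bound)
    show "(\<lambda>n. (1 / 2 :: real) ^ n) \<longlonglongrightarrow> 0"
      by (intro LIMSEQ_realpow_zero) auto
  qed simp
qed

lemma interval_length: "(a, b) \<in> cantor_intervals \<xi> n \<Longrightarrow> b = a + \<xi> n"
  using cantor_intervals_length[of \<xi> a b n] start by simp

lemma children_eq:
  assumes "(a, b) \<in> cantor_intervals \<xi> n"
  shows "remove_middle (\<xi> n - 2 * \<xi> (Suc n)) (a, b) =
    {(a, a + \<xi> (Suc n)), (b - \<xi> (Suc n), b)}"
proof -
  have "(a + b) / 2 - (\<xi> n - 2 * \<xi> (Suc n)) / 2 = a + \<xi> (Suc n)"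
    and "(a + b) / 2 + (\<xi> n - 2 * \<xi> (Suc n)) / 2 = b - \<xi> (Suc n)"
    using interval_length[OF assms] by argo+
  then show ?thesis by (simp add: remove_middle_def)
qed

lemma child_within:
  assumes "(a, b) \<in> cantor_intervals \<xi> n"
    and "(u, v) \<in> remove_middle (\<xi> n - 2 * \<xi> (Suc n)) (a, b)"
  shows "u \<in> {a..b}" and "{u..v} \<subseteq> {a..b}"
  using assms(2) interval_length[OF assms(1)] halves[of n] pos[of "Suc n"]
  unfolding children_eq[OF assms(1)] by auto

lemma child_cases:
  assumes "(u, v) \<in> cantor_intervals \<xi> (Suc n)"
  obtains a b where "(a, b) \<in> cantor_intervals \<xi> n"
    and "(u, v) = (a, a + \<xi> (Suc n)) \<or> (u, v) = (b - \<xi> (Suc n), b)"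
    and "{u..v} \<subseteq> {a..b}"
proof -
  obtain a b where ab: "(a, b) \<in> cantor_intervals \<xi> n"
    and uv: "(u, v) \<in> remove_middle (\<xi> n - 2 * \<xi> (Suc n)) (a, b)"
    using assms by auto
  have "(u, v) = (a, a + \<xi> (Suc n)) \<or> (u, v) = (b - \<xi> (Suc n), b)"
    using uv children_eq[OF ab] by simp
  then show ?thesis using that ab child_within(2)[OF ab uv] by blast
qed

text \<open>
  Distinct intervals of one stage are disjoint: a common point lies in both parents, which
  therefore coincide; the two children of one parent are separated by the removed interval.
\<close>

lemma interval_eqI:
  assumes "(a, b) \<in> cantor_intervals \<xi> n" "(u, v) \<in> cantor_intervals \<xi> n"
    and "x \<in> {a..b}" "x \<in> {u..v}"
  shows "(a, b) = (u, v)"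
  using assms
proof (induction n arbitrary: a b u v)
  case (Suc n)
  obtain a' b' where 1: "(a', b') \<in> cantor_intervals \<xi> n"
    "(a, b) = (a', a' + \<xi> (Suc n)) \<or> (a, b) = (b' - \<xi> (Suc n), b')" "{a..b} \<subseteq> {a'..b'}"
    using child_cases[OF Suc.prems(1)] by metis
  obtain u' v' where 2: "(u', v') \<in> cantor_intervals \<xi> n"
    "(u, v) = (u', u' + \<xi> (Suc n)) \<or> (u, v) = (v' - \<xi> (Suc n), v')" "{u..v} \<subseteq> {u'..v'}"
    using child_cases[OF Suc.prems(2)] by metis
  have "(a', b') = (u', v')"
    using Suc.IH[OF 1(1) 2(1)] 1(3) 2(3) Suc.prems(3,4) by blast
  moreover have "a' + \<xi> (Suc n) < b' - \<xi> (Suc n)"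
    using interval_length[OF 1(1)] halves[of n] by linarith
  ultimately show ?case
    using 1(2) 2(2) Suc.prems(3,4) by (elim disjE) auto
qed simp

lemma finite_intervals: "finite (cantor_intervals \<xi> n)"
  by (induction n) (auto simp: remove_middle_def)

text \<open>
  The intervals of a stage form a set, so that the count needs that no interval is a child
  of two different parents: its left endpoint would be a point common to both.
\<close>

lemma card_intervals: "card (cantor_intervals \<xi> n) = 2 ^ n"
proof (induction n)
  case (Suc n)
  let ?ch = "remove_middle (\<xi> n - 2 * \<xi> (Suc n))"
  have card2: "card (?ch I) = 2" if I: "I \<in> cantor_intervals \<xi> n" for I
  proof -
    obtain a b where ab: "I = (a, b)" by force
    have "a \<noteq> b - \<xi> (Suc n)"
      using interval_length[of a b n] I halves[of n] pos[of "Suc n"] ab by auto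
    then show ?thesis using children_eq[of a b n] I ab by auto
  qed
  have disj: "?ch I \<inter> ?ch J = {}"
    if I: "I \<in> cantor_intervals \<xi> n" and J: "J \<in> cantor_intervals \<xi> n" and "I \<noteq> J" for I J
  proof (rule ccontr)
    assume "?ch I \<inter> ?ch J \<noteq> {}"
    then obtain u v where uv: "(u, v) \<in> ?ch I" "(u, v) \<in> ?ch J" by fastforce
    obtain a b c d where ab: "I = (a, b)" and cd: "J = (c, d)" by force
    have "u \<in> {a..b}" "u \<in> {c..d}"
      using child_within(1) I J uv unfolding ab cd by blast+
    then show False using interval_eqI I J \<open>I \<noteq> J\<close> unfolding ab cd by blast
  qed
  have "card (\<Union>I\<in>cantor_intervals \<xi> n. ?ch I) = (\<Sum>I\<in>cantor_intervals \<xi> n. card (?ch I))"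
    using disj by (intro card_UN_disjoint finite_intervals) (auto simp: remove_middle_def)
  then show ?case using Suc card2 by simp
qed simp

lemma closed_stage: "closed (cantor_stage \<xi> n)"
  unfolding cantor_stage_def using finite_intervals by (intro closed_UN) auto

lemma decseq_stage: "decseq (cantor_stage \<xi>)"
proof (rule decseq_SucI, rule subsetI)
  fix n x assume "x \<in> cantor_stage \<xi> (Suc n)"
  then obtain u v where uv: "(u, v) \<in> cantor_intervals \<xi> (Suc n)" "x \<in> {u..v}"
    by (auto simp: cantor_stage_def simp del: cantor_intervals.simps)
  obtain a b where "(a, b) \<in> cantor_intervals \<xi> n" "{u..v} \<subseteq> {a..b}"
    using child_cases[OF uv(1)] by metis
  then show "x \<in> cantor_stage \<xi> n"
    using uv(2) unfolding cantor_stage_def by blast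
qed

lemma emeasure_stage: "emeasure lebesgue (cantor_stage \<xi> n) = ennreal (2 ^ n * \<xi> n)"
proof -
  let ?X = "\<lambda>(a, b). {a..b} :: real set"
  have "disjoint_family_on ?X (cantor_intervals \<xi> n)"
    unfolding disjoint_family_on_def using interval_eqI by fast
  then have "(\<Sum>I\<in>cantor_intervals \<xi> n. emeasure lebesgue (?X I)) =
      emeasure lebesgue (cantor_stage \<xi> n)"
    unfolding cantor_stage_def using finite_intervals by (intro sum_emeasure) auto
  moreover have "(\<Sum>I\<in>cantor_intervals \<xi> n. emeasure lebesgue (?X I)) =
      (\<Sum>I\<in>cantor_intervals \<xi> n. ennreal (\<xi> n))"
    using pos[of n] by (intro sum.cong) (auto dest: interval_length)
  ultimately show ?thesis
    using card_intervals pos[of n]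
    by (simp add: ennreal_of_nat_eq_real_of_nat ennreal_mult less_imp_le)
qed

lemma closed_cantor: "closed (generalized_cantor_set \<xi>)"
  unfolding generalized_cantor_set_def using closed_stage by auto

lemma measure_cantor:
  assumes "(\<lambda>n. 2 ^ n * \<xi> n) \<longlonglongrightarrow> L"
  shows "measure lebesgue (generalized_cantor_set \<xi>) = L"
proof -
  have "(\<lambda>n. measure lebesgue (cantor_stage \<xi> n)) \<longlonglongrightarrow>
      measure lebesgue (\<Inter>n. cantor_stage \<xi> n)"
    using closed_stage decseq_stage emeasure_stage
    by (intro Lim_measure_decseq) (auto intro: borel_closed)
  moreover have "measure lebesgue (cantor_stage \<xi> n) = 2 ^ n * \<xi> n" for n
    using emeasure_stage[of n] pos[of n] by (simp add: measure_def)
  ultimately show ?thesis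
    using assms LIMSEQ_unique unfolding generalized_cantor_set_def by fastforce
qed

lemma stage_subset_unit: "cantor_stage \<xi> n \<subseteq> {0..1}"
  using decseqD[OF decseq_stage, of 0 n] by (simp add: cantor_stage_def)

lemma cantor_subset_unit: "generalized_cantor_set \<xi> \<subseteq> {0..1}"
  using stage_subset_unit unfolding generalized_cantor_set_def by blast

lemma zero_in_cantor: "0 \<in> generalized_cantor_set \<xi>"
proof -
  have "(0, \<xi> n) \<in> cantor_intervals \<xi> n" for n
  proof (induction n)
    case (Suc n)
    then show ?case using children_eq[OF Suc] by force
  qed (simp add: start)
  moreover have "0 \<in> {0..\<xi> n}" for n using pos[of n] by simp
  ultimately show ?thesis
    unfolding generalized_cantor_set_def cantor_stage_def by blast
qed

text \<open>
  An interval of stage \<open>n + 1\<close> that contains the midpoint has a parent that meets \<open>{a..b}\<close> there, so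
  the parent is \<open>{a..b}\<close> itself; but the midpoint is in neither of its children.
\<close>

lemma midpoint_notin_stage:
  assumes "(a, b) \<in> cantor_intervals \<xi> n"
  shows "(a + b) / 2 \<notin> cantor_stage \<xi> (Suc n)"
proof
  assume "(a + b) / 2 \<in> cantor_stage \<xi> (Suc n)"
  then obtain u v where uv: "(u, v) \<in> cantor_intervals \<xi> (Suc n)" "(a + b) / 2 \<in> {u..v}"
    by (auto simp: cantor_stage_def simp del: cantor_intervals.simps)
  obtain c d where cd: "(c, d) \<in> cantor_intervals \<xi> n"
    "(u, v) = (c, c + \<xi> (Suc n)) \<or> (u, v) = (d - \<xi> (Suc n), d)" "{u..v} \<subseteq> {c..d}"
    using child_cases[OF uv(1)] by metis
  have len: "b = a + \<xi> n" by (rule interval_length[OF assms])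
  have "(a, b) = (c, d)"
    using interval_eqI[OF assms cd(1), of "(a + b) / 2"] uv(2) cd(3) len pos[of n] by auto
  then show False using cd(2) uv(2) len halves[of n] by auto
qed

lemma cantor_subset_closure_complement:
  "generalized_cantor_set \<xi> \<subseteq> closure ({0..1} - generalized_cantor_set \<xi>)"
proof
  fix x assume x: "x \<in> generalized_cantor_set \<xi>"
  have "\<exists>y\<in>{0..1} - generalized_cantor_set \<xi>. dist y x < e" if e: "e > 0" for e
  proof -
    obtain n where n: "\<xi> n < e"
      using order_tendstoD(2)[OF tendsto_0 e] by (auto simp: eventually_sequentially)
    obtain a b where ab: "(a, b) \<in> cantor_intervals \<xi> n" "x \<in> {a..b}"
      using x unfolding generalized_cantor_set_def cantor_stage_def by blast
    have len: "b = a + \<xi> n" by (rule interval_length[OF ab(1)])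
    have "(a + b) / 2 \<in> {a..b}" using len pos[of n] by simp
    then have "(a + b) / 2 \<in> cantor_stage \<xi> n"
      unfolding cantor_stage_def using ab(1) by blast
    moreover have "(a + b) / 2 \<notin> generalized_cantor_set \<xi>"
      using midpoint_notin_stage[OF ab(1)] unfolding generalized_cantor_set_def by blast
    moreover have "dist ((a + b) / 2) x < e"
      using ab(2) len n pos[of n] by (auto simp: dist_real_def abs_less_iff field_simps)
    ultimately show ?thesis using stage_subset_unit by blast
  qed
  then show "x \<in> closure ({0..1} - generalized_cantor_set \<xi>)"
    by (simp add: closure_approachable)
qed

end

section \<open>A damped sine with unbounded variation at zero\<close>

text \<open>
  At \<open>0\<close> the convention \<open>1 / 0 = 0\<close> yields the value \<open>0\<close>, which is the continuous extension.
\<close>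

definition damped_sine :: "real \<Rightarrow> real" where
  "damped_sine t = t * sin (1 / t)"

lemma continuous_damped_sine: "continuous_on S damped_sine"
proof -
  have "isCont damped_sine t" for t
  proof (cases "t = 0")
    case True
    have "(damped_sine \<longlongrightarrow> 0) (at 0)"
    proof (rule Lim_null_comparison)
      show "\<forall>\<^sub>F t in at 0. norm (damped_sine t) \<le> \<bar>t\<bar>"
        by (intro always_eventually)
          (simp add: damped_sine_def abs_mult mult_left_le)
      show "((\<lambda>t::real. \<bar>t\<bar>) \<longlongrightarrow> 0) (at 0)"
        by (intro tendsto_eq_intros) auto
    qed
    then show ?thesis using True by (simp add: isCont_def damped_sine_def)
  next
    case False
    then show ?thesis unfolding damped_sine_def[abs_def] by (intro continuous_intros) auto
  qed
  then show ?thesis by (simp add: continuous_at_imp_continuous_on)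
qed

text \<open>
  These are the points at which \<open>sin (1 / t)\<close> is alternately \<open>1\<close> and \<open>- 1\<close>.
\<close>

definition peak :: "nat \<Rightarrow> real" where
  "peak k = 1 / ((real k + 1 / 2) * pi)"

lemma peak_pos: "0 < peak k"
  by (simp add: peak_def add_nonneg_pos)

lemma peak_strict_decreasing: "peak (Suc k) < peak k"
  unfolding peak_def by (intro divide_strict_left_mono) (auto intro!: mult_pos_pos add_nonneg_pos)

lemma damped_sine_peak: "damped_sine (peak k) = (- 1) ^ k * peak k"
proof -
  have "sin ((real k + 1 / 2) * pi) = cos (real k * pi)"
    by (simp add: sin_add distrib_right)
  then show ?thesis by (simp add: damped_sine_def peak_def cos_npi)
qed

lemma not_summable_peak: "\<not> summable peak"
proof
  assume "summable peak"
  then have "summable (\<lambda>k. pi * peak k)" by (rule summable_mult)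
  then have "summable (\<lambda>k. 1 / real (Suc k))"
  proof (rule summable_comparison_test')
    fix k :: nat
    show "norm (1 / real (Suc k)) \<le> pi * peak k"
    proof -
      have "pi * peak k = 1 / (real k + 1 / 2)" by (simp add: peak_def)
      then show ?thesis by (simp add: frac_le)
    qed
  qed
  then show False
    using not_summable_harmonic[where 'a = real] summable_Suc_iff[of "\<lambda>k. 1 / real k"]
    by (simp add: inverse_eq_divide)
qed

lemma peak_tendsto_0: "peak \<longlonglongrightarrow> 0"
proof (rule tendsto_sandwich[where f = "\<lambda>_. 0"])
  show "\<forall>\<^sub>F k in sequentially. peak k \<le> inverse (real (Suc k))"
  proof (intro always_eventually allI)
    fix k
    have "real (Suc k) \<le> (real k + 1 / 2) * 2" by simp
    also have "\<dots> \<le> (real k + 1 / 2) * pi" using pi_ge_two by (intro mult_left_mono) auto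
    finally show "peak k \<le> inverse (real (Suc k))"
      by (simp add: peak_def inverse_eq_divide frac_le)
  qed
qed (use peak_pos LIMSEQ_inverse_real_of_nat in \<open>auto intro!: always_eventually less_imp_le\<close>)

section \<open>Oscillation along the distance to a closed set\<close>

definition oscillation :: "real set \<Rightarrow> real \<Rightarrow> real" where
  "oscillation B x = damped_sine (infdist x B)"

lemma continuous_oscillation: "continuous_on S (oscillation B)"
  unfolding oscillation_def
  by (rule continuous_on_compose2[OF continuous_damped_sine[of UNIV]])
    (auto intro: continuous_intros)

text \<open>
  The density of the complement supplies a point \<open>y \<notin> B\<close> near \<open>x\<close>, and closedness of \<open>B\<close> makes its
  distance to \<open>B\<close> positive. By connectedness of the segment from \<open>x\<close> to \<open>y\<close>, every small peak is the
  distance to \<open>B\<close> of a point of that segment.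
\<close>

lemma oscillation_cuts_axis:
  assumes "closed B" "B \<subseteq> {0..1}" "B \<subseteq> closure ({0..1} - B)" "x \<in> B"
  shows "cuts_axis_at (oscillation B) x"
  unfolding cuts_axis_at_def
proof (intro conjI allI impI)
  show "x \<in> {0..1}" using assms by blast
  show "oscillation B x = 0" using assms(4) by (simp add: oscillation_def damped_sine_def)
  fix \<delta> :: real assume "\<delta> > 0"
  moreover have "x \<in> closure ({0..1} - B)" using assms(3,4) by blast
  ultimately obtain y where y: "y \<in> {0..1}" "y \<notin> B" "dist y x < \<delta>"
    unfolding closure_approachable by blast
  have "0 < infdist y B"
    using infdist_pos_not_in_closed[OF assms(1) _ y(2)] assms(4) by blast
  then obtain k where k: "\<And>n. n \<ge> k \<Longrightarrow> peak n < infdist y B"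
    using order_tendstoD(2)[OF peak_tendsto_0] by (auto simp: eventually_sequentially)
  have reach: "\<exists>z\<in>{0..1}. \<bar>x - z\<bar> < \<delta> \<and> oscillation B z = (- 1) ^ n * peak n" if "n \<ge> k" for n
  proof -
    have "connected ((\<lambda>z. infdist z B) ` closed_segment x y)"
      by (intro connected_continuous_image continuous_intros) auto
    moreover have "0 \<in> (\<lambda>z. infdist z B) ` closed_segment x y"
      using assms(4) by (intro image_eqI[of _ _ x]) auto
    moreover have "infdist y B \<in> (\<lambda>z. infdist z B) ` closed_segment x y"
      by (rule imageI) simp
    ultimately have "peak n \<in> (\<lambda>z. infdist z B) ` closed_segment x y"
      by (rule connectedD_interval) (use k[OF that] peak_pos[of n] in linarith)+
    then obtain z where z: "z \<in> closed_segment x y" "infdist z B = peak n" by auto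
    have "z \<in> {0..1}"
      using closed_segment_subset[OF _ y(1) convex_real_interval(5)] z(1) assms(2,4) by blast
    moreover have "\<bar>x - z\<bar> < \<delta>"
      using dist_in_closed_segment[OF z(1)] y(3)
      by (simp add: dist_real_def abs_minus_commute)
    ultimately show ?thesis using z(2) by (auto simp: oscillation_def damped_sine_peak)
  qed
  obtain x1 where "x1 \<in> {0..1}" "\<bar>x - x1\<bar> < \<delta>" "oscillation B x1 < 0"
    using reach[of "2 * k + 1"] peak_pos[of "2 * k + 1"] by auto
  moreover obtain x2 where "x2 \<in> {0..1}" "\<bar>x - x2\<bar> < \<delta>" "0 < oscillation B x2"
    using reach[of "2 * k"] peak_pos[of "2 * k"] by auto
  ultimately show "\<exists>x1\<in>{0..1}. \<exists>x2\<in>{0..1}. \<bar>x - x1\<bar> < \<delta> \<and> \<bar>x - x2\<bar> < \<delta> \<and>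
      oscillation B x1 < 0 \<and> 0 < oscillation B x2"
    by blast
qed

text \<open>
  Peaks approach \<open>0\<close> as their index grows, so they are met from right to left. A finite decreasing
  sequence in the open unit interval, read backwards and completed by \<open>0\<close> and \<open>1\<close>, is
  a partition.
\<close>

lemma bounded_variation_decreasing_sums:
  assumes "bounded_variation_unit f"
  obtains M where "\<And>n q. (\<And>i. i < n \<Longrightarrow> q (Suc i) < q i) \<Longrightarrow> 0 < q n \<Longrightarrow> q 0 < 1 \<Longrightarrow>
    (\<Sum>i<n. \<bar>f (q i) - f (q (Suc i))\<bar>) \<le> M"
proof -
  obtain M where M: "\<And>n t. unit_partition n t \<Longrightarrow> (\<Sum>i=1..n. \<bar>f (t i) - f (t (i - 1))\<bar>) \<le> M"
    using assms unfolding bounded_variation_unit_def bdd_above_def by blast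
  show ?thesis
  proof (rule that)
    fix n :: nat and q :: "nat \<Rightarrow> real"
    assume q: "\<And>i. i < n \<Longrightarrow> q (Suc i) < q i" "0 < q n" "q 0 < 1"
    define t where "t i = (if i = 0 then 0 else if i \<le> n + 1 then q (n + 1 - i) else 1)" for i
    have "unit_partition (n + 2) t"
      unfolding unit_partition_def
    proof (intro conjI allI impI)
      fix i assume "i < n + 2"
      then consider "i = 0" | "i = n + 1" | "0 < i" "i \<le> n" by linarith
      then show "t i < t (Suc i)"
      proof cases
        case 3
        then have "n + 1 - i = Suc (n - i)" by simp
        then show ?thesis using 3 q(1)[of "n - i"] by (simp add: t_def)
      qed (use q in \<open>simp_all add: t_def\<close>)
    qed (simp_all add: t_def)
    then have le: "(\<Sum>i=1..n+2. \<bar>f (t i) - f (t (i - 1))\<bar>) \<le> M" by (rule M)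
    have "(\<Sum>i<n. \<bar>f (q i) - f (q (Suc i))\<bar>) = (\<Sum>i=2..n+1. \<bar>f (t i) - f (t (i - 1))\<bar>)"
    proof (rule sum.reindex_bij_witness[where i = "\<lambda>i. n + 1 - i" and j = "\<lambda>i. n + 1 - i"])
      fix i assume "i \<in> {..<n}"
      then have "t (n + 1 - i) = q i" "t (n + 1 - i - 1) = q (Suc i)"
        by (auto simp: t_def Suc_diff_le intro!: arg_cong[of _ _ q])
      then show "\<bar>f (t (n + 1 - i)) - f (t (n + 1 - i - 1))\<bar> = \<bar>f (q i) - f (q (Suc i))\<bar>"
        by simp
    qed auto
    also have "\<dots> \<le> (\<Sum>i=1..n+2. \<bar>f (t i) - f (t (i - 1))\<bar>)"
      by (intro sum_mono2) auto
    finally show "(\<Sum>i<n. \<bar>f (q i) - f (q (Suc i))\<bar>) \<le> M" using le by simp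
  qed
qed

text \<open>
  Take \<open>c\<close> to be the last point of \<open>B\<close> before \<open>z\<close>. Then \<open>B\<close> does not meet the interval from \<open>c\<close> to
  \<open>z\<close>, and in its left half \<open>c\<close> is a nearest point of \<open>B\<close>.
\<close>

lemma infdist_right_of_set:
  assumes "closed B" "a \<in> B" "a < z" "z \<notin> B"
  obtains c where "a \<le> c" "c < z" "\<And>t. 0 \<le> t \<Longrightarrow> t \<le> (z - c) / 2 \<Longrightarrow> infdist (c + t) B = t"
proof -
  have "compact (B \<inter> {a..z})" "B \<inter> {a..z} \<noteq> {}"
    using assms by (auto intro: closed_Int_compact)
  then obtain c where c: "c \<in> B \<inter> {a..z}" "\<And>b. b \<in> B \<inter> {a..z} \<Longrightarrow> b \<le> c"
    using compact_attains_sup by metis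
  have "infdist (c + t) B = t" if t: "0 \<le> t" "t \<le> (z - c) / 2" for t
  proof (rule antisym)
    show "infdist (c + t) B \<le> t"
      using c(1) t(1) infdist_le[of c B "c + t"] by (simp add: dist_real_def)
    have "t \<le> dist (c + t) b" if b: "b \<in> B" for b
    proof (cases "b \<le> z")
      case True
      then have "b \<le> c" using c b by (cases "a \<le> b") auto
      then show ?thesis using t by (simp add: dist_real_def)
    next
      case False
      then show ?thesis using t by (simp add: dist_real_def field_simps)
    qed
    then show "t \<le> infdist (c + t) B"
      using assms(2) by (auto simp: infdist_def intro!: cINF_greatest)
  qed
  moreover have "c \<noteq> z" using c(1) assms(4) by auto
  ultimately show ?thesis using that[of c] c(1) by auto
qed

text \<open>
  At consecutive peaks to the right of \<open>c\<close> the function has opposite signs, so its increment is at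
  least as large as the first of the two peaks. Bounded variation would thus bound the partial sums of
  a divergent series.
\<close>

lemma oscillation_unbounded_variation:
  assumes "closed B" "a \<in> B" "0 \<le> a" "a < z" "z \<le> 1" "z \<notin> B"
  shows "\<not> bounded_variation_unit (oscillation B)"
proof
  assume "bounded_variation_unit (oscillation B)"
  then obtain M where M: "\<And>n q. (\<And>i. i < n \<Longrightarrow> q (Suc i) < q i) \<Longrightarrow> 0 < q n \<Longrightarrow> q 0 < 1 \<Longrightarrow>
      (\<Sum>i<n. \<bar>oscillation B (q i) - oscillation B (q (Suc i))\<bar>) \<le> M"
    using bounded_variation_decreasing_sums by blast
  obtain c where c: "a \<le> c" "c < z"
      "\<And>t. 0 \<le> t \<Longrightarrow> t \<le> (z - c) / 2 \<Longrightarrow> infdist (c + t) B = t"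
    using infdist_right_of_set assms by metis
  obtain k where k: "\<And>n. n \<ge> k \<Longrightarrow> peak n < (z - c) / 2"
    using order_tendstoD(2)[OF peak_tendsto_0, of "(z - c) / 2"] c(2)
    by (auto simp: eventually_sequentially)
  have osc: "oscillation B (c + peak (i + k)) = (- 1) ^ (i + k) * peak (i + k)" for i
    using c(3)[of "peak (i + k)"] k[of "i + k"] peak_pos[of "i + k"]
    by (simp add: oscillation_def damped_sine_peak)
  have "(\<Sum>i<n. peak (i + k)) \<le> M" for n
  proof -
    have "(\<Sum>i<n. peak (i + k)) \<le>
        (\<Sum>i<n. \<bar>oscillation B (c + peak (i + k)) - oscillation B (c + peak (Suc i + k))\<bar>)"
    proof (rule sum_mono)
      fix i
      have "\<bar>oscillation B (c + peak (i + k)) - oscillation B (c + peak (Suc i + k))\<bar> =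
          \<bar>(- 1) ^ (i + k) * (peak (i + k) + peak (Suc i + k))\<bar>"
        unfolding osc by (simp add: algebra_simps)
      then show "peak (i + k) \<le>
          \<bar>oscillation B (c + peak (i + k)) - oscillation B (c + peak (Suc i + k))\<bar>"
        using peak_pos[of "i + k"] peak_pos[of "Suc i + k"] by (simp add: abs_mult)
    qed
    also have "\<dots> \<le> M"
    proof (rule M[of n "\<lambda>i. c + peak (i + k)"])
      show "0 < c + peak (n + k)" using c(1) assms(3) peak_pos[of "n + k"] by linarith
      show "c + peak (0 + k) < 1" using k[of k] c(2) assms(5) by (simp add: field_simps)
    qed (simp add: peak_strict_decreasing)
    finally show ?thesis .
  qed
  then have "summable (\<lambda>i. peak (i + k))"
    using peak_pos by (intro summableI_nonneg_bounded) (auto intro: less_imp_le)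
  then show False using not_summable_peak by (simp add: summable_iff_shift)
qed

theorem theorem1:
  fixes \<alpha> :: real and \<xi> :: "nat \<Rightarrow> real" and B :: "real set"
  assumes "0 < \<alpha>" and "\<alpha> < 1"
    and "\<And>n. \<xi> n = \<alpha> / 2 ^ n + (1 - \<alpha>) / 3 ^ n"
    and "B = generalized_cantor_set \<xi>"
  shows "B \<in> sets lebesgue \<and> measure lebesgue B = \<alpha> \<and>
    (\<exists>f :: real \<Rightarrow> real. continuous_on {0..1} f \<and> \<not> bounded_variation_unit f \<and>
       (\<forall>x\<in>B. cuts_axis_at f x))"
proof -
  interpret cantor_sequence \<xi>
    using admissible_sequence[OF assms(1-3)] by unfold_locales
  have closed: "closed B" and sub: "B \<subseteq> {0..1}" and zero: "0 \<in> B"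
    and dense: "B \<subseteq> closure ({0..1} - B)"
    unfolding assms(4)
    by (fact closed_cantor cantor_subset_unit zero_in_cantor cantor_subset_closure_complement)+
  have "2 ^ n * \<xi> n = \<alpha> + (1 - \<alpha>) * (2 / 3) ^ n" for n
    unfolding assms(3) by (simp add: field_simps power_divide)
  moreover have "(\<lambda>n. \<alpha> + (1 - \<alpha>) * (2 / 3) ^ n) \<longlonglongrightarrow> \<alpha> + (1 - \<alpha>) * 0"
    by (intro tendsto_intros LIMSEQ_realpow_zero) auto
  ultimately have "measure lebesgue B = \<alpha>"
    unfolding assms(4) by (intro measure_cantor) simp
  moreover have "B \<in> sets lebesgue"
    using closed by (auto intro: borel_closed)
  moreover have "\<not> bounded_variation_unit (oscillation B)"
  proof -
    have "{0..1} - B \<noteq> {}"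
      using zero dense by (metis closure_empty empty_iff subsetD)
    then obtain z where z: "z \<in> {0..1} - B" by blast
    then have "z \<noteq> 0" using zero by blast
    then show ?thesis
      using z zero closed by (intro oscillation_unbounded_variation[of B 0 z]) auto
  qed
  ultimately show ?thesis
    using oscillation_cuts_axis[OF closed sub dense]
    by (intro conjI exI[of _ "oscillation B"]) (auto intro: continuous_oscillation)
qed

end
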